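(* Let $\mathcal X,\mathcal Y$ be finite-dimensional Euclidean spaces, $A:\mathcal X\to\mathcal Y$ a linear map with adjoint $A^*$, $\kappa:\mathcal X\to\mathbb R\cup\{+\infty\}$ a gauge, and $\rho:\mathcal Y\to\mathbb R\cup\{+\infty\}$ a closed gauge. Fix $b\in\mathcal Y$ and $\sigma\ge0$, and if $\sigma=0$ assume in addition $\rho^{-1}(0)=\{0\}$. For $x\in\mathcal X$, $h\in\mathcal Y$, $k\in\mathbb R$ define $$f(x,h,k)=\kappa(x)+\delta_{\operatorname{epi}\rho}(b+h-Ax,\ \sigma+k),\qquad v(h,k)=\inf_x f(x,h,k).$$ Then $$\operatorname{dom}f(\cdot,0,0)\neq\emptyset\iff 0\in A\operatorname{dom}\kappa-[\rho(b-\cdot)\le\sigma],$$ and hence $$(0,0)\in\operatorname{int}\operatorname{dom}v\iff 0\in\operatorname{int}\bigl(A\operatorname{dom}\kappa-[\rho(b-\cdot)<\sigma]\bigr).$$ If $(0,0)\in\operatorname{int}\operatorname{dom}v$ and $v(0,0)>0$, then $\partial v(0,0)\neq\emptyset$, with $$\begin{aligned}\partial v(0,0)&=\Bigl\{(y,-\rho^\circ(y))\ \Big|\ y\in\operatorname*{arg\,max}_y\{\langle b,y\rangle-\sigma\rho^\circ(y)\mid\kappa^\circ(A^*y)\le1\}\Bigr\}\\&=\Bigl\{v(0,0)\cdot(y,-\rho^\circ(y))\ \Big|\ y\in\operatorname*{arg\,min}_y\{\kappa^\circ(A^*y)\mid\langle b,y\rangle-\sigma\rho^\circ(y)\ge1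\}\Bigr\}.\end{aligned}$$
   Context: A gauge is a nonnegative, positively homogeneous convex function $\kappa$ with values in $\mathbb R\cup\{+\infty\}$ and $\kappa(0)=0$. It is closed if its epigraph is closed. Its polar is the gauge $\kappa^\circ(y)=\inf\{\mu>0\mid\langle x,y\rangle\le\mu\kappa(x)\ \forall x\}$ (with $\inf\emptyset=+\infty$). The domain of a function is the set where it is $<+\infty$; $\operatorname{epi}\rho=\{(r,\mu)\mid\rho(r)\le\mu\}$; $\delta_{\mathcal D}$ is the indicator function of $\mathcal D$ ($0$ on $\mathcal D$, $+\infty$ off $\mathcal D$). $[\rho(b-\cdot)\le\sigma]$ denotes $\{u\in\mathcal Y\mid\rho(b-u)\le\sigma\}$, and similarly with $<$. $A\operatorname{dom}\kappa$ is the image of $\operatorname{dom}\kappa$ under $A$, and a difference of sets is the Minkowski difference $\{p-q\mid p\in P,\ q\in Q\}$. $\partial v$ is the convex subdifferential. *)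

theory Defs
  imports "HOL-Analysis.Analysis"
begin

definition epi :: "('a \<Rightarrow> ereal) \<Rightarrow> ('a \<times> real) set" where
  "epi g = {(r, \<mu>). g r \<le> ereal \<mu>}"

definition effective_dom :: "('a \<Rightarrow> ereal) \<Rightarrow> 'a set" where
  "effective_dom g = {x. g x < \<infinity>}"

(* 0 on D and +infinity off D, unlike the 0/1-valued indicator of the library *)
definition delta :: "'a set \<Rightarrow> 'a \<Rightarrow> ereal" where
  "delta D x = (if x \<in> D then 0 else \<infinity>)"

(* Convexity of an extended-valued function is convexity of its epigraph.
   Nonnegativity excludes the value -infinity. *)
definition gauge_fun :: "('a::real_vector \<Rightarrow> ereal) \<Rightarrow> bool" where
  "gauge_fun \<kappa> \<longleftrightarrow>
     (\<forall>x. 0 \<le> \<kappa> x) \<and> \<kappa> 0 = 0 \<and>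
     (\<forall>t x. 0 < t \<longrightarrow> \<kappa> (t *\<^sub>R x) = ereal t * \<kappa> x) \<and>
     convex (epi \<kappa>)"

definition closed_gauge :: "('a::real_normed_vector \<Rightarrow> ereal) \<Rightarrow> bool" where
  "closed_gauge \<kappa> \<longleftrightarrow> gauge_fun \<kappa> \<and> closed (epi \<kappa>)"

(* mu ranges over the (finite) positive reals; the infimum of the empty set is +infinity *)
definition polar :: "('a::real_inner \<Rightarrow> ereal) \<Rightarrow> 'a \<Rightarrow> ereal" where
  "polar \<kappa> y = Inf {ereal \<mu> | \<mu>. 0 < \<mu> \<and> (\<forall>x. ereal (x \<bullet> y) \<le> ereal \<mu> * \<kappa> x)}"

(* the operator "-" on sets is set difference *)
definition minkowski_diff :: "'a::ab_group_add set \<Rightarrow> 'a set \<Rightarrow> 'a set" where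
  "minkowski_diff P Q = {p - q | p q. p \<in> P \<and> q \<in> Q}"

definition subdifferential :: "('a::real_inner \<Rightarrow> ereal) \<Rightarrow> 'a \<Rightarrow> 'a set" where
  "subdifferential g x = {s. \<forall>z. g x + ereal (s \<bullet> (z - x)) \<le> g z}"

definition perturbation_fun ::
  "('a \<Rightarrow> ereal) \<Rightarrow> ('b::real_vector \<Rightarrow> ereal) \<Rightarrow> ('a \<Rightarrow> 'b) \<Rightarrow> 'b \<Rightarrow> real \<Rightarrow> 'a \<Rightarrow> 'b \<Rightarrow> real \<Rightarrow> ereal" where
  "perturbation_fun \<kappa> \<rho> A b \<sigma> x h k = \<kappa> x + delta (epi \<rho>) (b + h - A x, \<sigma> + k)"

definition value_fun ::
  "('a \<Rightarrow> ereal) \<Rightarrow> ('b::real_vector \<Rightarrow> ereal) \<Rightarrow> ('a \<Rightarrow> 'b) \<Rightarrow> 'b \<Rightarrow> real \<Rightarrow> 'b \<times> real \<Rightarrow> ereal" where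
  "value_fun \<kappa> \<rho> A b \<sigma> = (\<lambda>(h, k). INF x. perturbation_fun \<kappa> \<rho> A b \<sigma> x h k)"

(* If rho is a closed gauge with rho^{-1}(0) = {0} then polar rho is finite everywhere, so under
   the standing assumptions the convention 0 * infinity = 0 of ereal never matters for sigma = 0. *)
definition dual_objective ::
  "('b::real_inner \<Rightarrow> ereal) \<Rightarrow> 'b \<Rightarrow> real \<Rightarrow> 'b \<Rightarrow> ereal" where
  "dual_objective \<rho> b \<sigma> y = ereal (b \<bullet> y) - ereal \<sigma> * polar \<rho> y"

end

(* Writing the value function as an infimum over points (r, \<mu>) of the epigraph of \<rho>, the
   subgradient inequality at the origin splits, by homogeneity, into a dual feasibility condition
   on each gauge and one scalar inequality; weak duality turns the latter into optimality.
   Existence of a subgradient comes from separating (0, v 0) from the strict epigraph of v, and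
   the second dual problem is the first one rescaled by v 0. *)
theory Submission
  imports Defs
begin

text \<open>The infimum defining \<open>v\<close> need not be attained, so no argument picks an
  optimal \<open>x\<close>: estimates start from a strict bound \<open>v z < \<alpha>\<close>, which
  does have a witness, and pass to the limit by density. The degenerate case
  \<open>\<sigma> = 0\<close> cannot occur together with the interior hypothesis: lowering
  \<open>k\<close> slightly below 0 must leave \<open>\<sigma> + k\<close> an upper bound for a
  value of the nonnegative function \<open>\<rho>\<close>. Positivity of \<open>\<sigma>\<close>
  then does two jobs. It pins the second component of a subgradient to
  \<open>- polar \<rho> y\<close>, and it makes the dual objective equal to
  \<open>-\<infinity>\<close> wherever \<open>polar \<rho> y\<close> is infinite. In the equivalence
  of the two interiors the obstacle is uniformity: the slack below \<open>\<sigma>\<close> depends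
  on the point of the neighbourhood.\<close>

lemma gauge_nonneg: "gauge_fun g \<Longrightarrow> 0 \<le> g x"
  by (simp add: gauge_fun_def)

lemma gauge_zero: "gauge_fun g \<Longrightarrow> g 0 = 0"
  by (simp add: gauge_fun_def)

lemma gauge_bound_nonneg:
  assumes "gauge_fun g" "g x \<le> ereal \<mu>"
  shows "0 \<le> \<mu>"
  using order_trans[OF gauge_nonneg[OF assms(1)] assms(2)] by simp

lemma gauge_scale_le:
  assumes "gauge_fun g" "0 < t" "g x \<le> ereal \<mu>"
  shows "g (t *\<^sub>R x) \<le> ereal (t * \<mu>)"
proof -
  have "g (t *\<^sub>R x) = ereal t * g x"
    using assms(1,2) by (simp add: gauge_fun_def)
  also have "\<dots> \<le> ereal t * ereal \<mu>"
    using assms(2,3) by (intro ereal_mult_left_mono) auto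
  finally show ?thesis by simp
qed

lemma gauge_convex_le:
  assumes "gauge_fun g" "g x \<le> ereal \<mu>" "g y \<le> ereal \<nu>" "0 \<le> s" "0 \<le> t" "s + t = 1"
  shows "g (s *\<^sub>R x + t *\<^sub>R y) \<le> ereal (s * \<mu> + t * \<nu>)"
proof -
  have "s *\<^sub>R (x, \<mu>) + t *\<^sub>R (y, \<nu>) \<in> epi g"
  proof (rule convexD)
    show "convex (epi g)" using assms(1) by (simp add: gauge_fun_def)
  qed (use assms in \<open>simp_all add: epi_def\<close>)
  then show ?thesis by (simp add: epi_def)
qed

section \<open>Polars and positive homogeneity of the dual objective\<close>

lemma polar_nonneg: "0 \<le> polar g y"
  unfolding polar_def by (rule Inf_greatest) auto

text \<open>Quantifying over epigraph points instead of multiplying by \<open>g x\<close> avoids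
  \<open>0 * \<infinity> = 0\<close>, which would make the equivalence false for \<open>t = 0\<close>.\<close>

lemma polar_le_iff:
  assumes g: "\<And>x. 0 \<le> g x" and "0 \<le> t"
  shows "polar g y \<le> ereal t \<longleftrightarrow> (\<forall>x \<mu>. g x \<le> ereal \<mu> \<longrightarrow> x \<bullet> y \<le> t * \<mu>)"
proof
  assume le: "polar g y \<le> ereal t"
  show "\<forall>x \<mu>. g x \<le> ereal \<mu> \<longrightarrow> x \<bullet> y \<le> t * \<mu>"
  proof (intro allI impI)
    fix x \<mu> assume \<mu>: "g x \<le> ereal \<mu>"
    then have "0 \<le> \<mu>" using order_trans[OF g \<mu>] by simp
    \<comment> \<open>The infimum defining the polar may fail to be attained; \<open>s > t\<close>
      leaves room for an admissible multiplier \<open>m < s\<close>.\<close>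
    have bound: "x \<bullet> y \<le> s * \<mu>" if "t < s" for s
    proof -
      have "polar g y < ereal s" using le that by (simp add: le_less_trans)
      then obtain m where m: "0 < m" "m < s" "ereal (x \<bullet> y) \<le> ereal m * g x"
        unfolding polar_def Inf_less_iff by auto
      have "ereal m * g x \<le> ereal m * ereal \<mu>"
        using m \<mu> by (intro ereal_mult_left_mono) auto
      from order_trans[OF m(3) this] have "x \<bullet> y \<le> m * \<mu>" by simp
      also have "\<dots> \<le> s * \<mu>" using m \<open>0 \<le> \<mu>\<close> by (intro mult_right_mono) auto
      finally show ?thesis .
    qed
    show "x \<bullet> y \<le> t * \<mu>"
    \<comment> \<open>At \<open>\<mu> = 0\<close> the bound no longer depends on \<open>s\<close>;
      otherwise division by \<open>\<mu>\<close> lets \<open>s\<close> tend to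
      \<open>t\<close>.\<close>
    proof (cases "\<mu> = 0")
      case True
      then show ?thesis using bound[of "t + 1"] by simp
    next
      case False
      then have "\<mu> > 0" using \<open>0 \<le> \<mu>\<close> by simp
      have "(x \<bullet> y) / \<mu> \<le> t"
        by (rule dense_ge) (use bound \<open>\<mu> > 0\<close> in \<open>simp add: field_simps\<close>)
      then show ?thesis using \<open>\<mu> > 0\<close> by (simp add: field_simps)
    qed
  qed
next
  assume *: "\<forall>x \<mu>. g x \<le> ereal \<mu> \<longrightarrow> x \<bullet> y \<le> t * \<mu>"
  \<comment> \<open>The polar admits positive multipliers only and \<open>t\<close> may be 0, hence
    the detour through \<open>s > t\<close>. Positivity of \<open>s\<close> also makes
    \<open>s * \<infinity>\<close> infinite where \<open>g x = \<infinity>\<close>.\<close>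
  have "polar g y \<le> ereal s" if "t < s" for s
  proof -
    have "ereal (x \<bullet> y) \<le> ereal s * g x" for x
    proof (cases "g x")
      case (real c)
      then have "0 \<le> c" using g[of x] by simp
      then have "t * c \<le> s * c" using that by (intro mult_right_mono) auto
      moreover have "x \<bullet> y \<le> t * c" using * real by simp
      ultimately show ?thesis using real by simp
    qed (use g[of x] that \<open>0 \<le> t\<close> in auto)
    then show ?thesis
      unfolding polar_def using that \<open>0 \<le> t\<close> by (intro Inf_lower) auto
  qed
  then have "polar g y \<le> ereal t + ereal e" if "0 < e" for e
    using that by simp
  then show "polar g y \<le> ereal t"
    by (rule ereal_le_epsilon2)
qed

text \<open>Multiplication by \<open>c\<close> carries the admissible multipliers for
  \<open>y\<close> onto those for \<open>c *\<^sub>R y\<close>, and a positive factor commutes with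
  the infimum.\<close>

lemma polar_scale:
  assumes "0 < c"
  shows "polar g (c *\<^sub>R y) = ereal c * polar g y"
proof -
  have iff: "ereal (x \<bullet> (c *\<^sub>R y)) \<le> ereal (c * m) * g x \<longleftrightarrow> ereal (x \<bullet> y) \<le> ereal m * g x" for x m
  proof -
    have "ereal (x \<bullet> (c *\<^sub>R y)) \<le> ereal (c * m) * g x \<longleftrightarrow>
        ereal c * ereal (x \<bullet> y) \<le> ereal c * (ereal m * g x)"
      by (simp add: mult.assoc flip: times_ereal.simps(1))
    also have "\<dots> \<longleftrightarrow> ereal (x \<bullet> y) \<le> ereal m * g x"
      using assms by (subst ereal_mult_le_mult_iff) auto
    finally show ?thesis .
  qed
  let ?M = "{\<mu>. 0 < \<mu> \<and> (\<forall>x. ereal (x \<bullet> y) \<le> ereal \<mu> * g x)}"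
  have "{ereal \<mu> |\<mu>. 0 < \<mu> \<and> (\<forall>x. ereal (x \<bullet> (c *\<^sub>R y)) \<le> ereal \<mu> * g x)} =
      {ereal c * z |z. z \<in> ereal ` ?M}" (is "?L = ?R")
  proof (intro equalityI subsetI)
    fix z assume "z \<in> ?L"
    then obtain \<mu> where \<mu>: "z = ereal \<mu>" "0 < \<mu>"
      "\<forall>x. ereal (x \<bullet> (c *\<^sub>R y)) \<le> ereal \<mu> * g x" by blast
    have "\<mu> / c \<in> ?M" using \<mu> assms iff[of _ "\<mu> / c"] by simp
    moreover have "z = ereal c * ereal (\<mu> / c)" using \<mu> assms by simp
    ultimately show "z \<in> ?R" by blast
  next
    fix z assume "z \<in> ?R"
    then obtain \<mu> where "z = ereal c * ereal \<mu>" and \<mu>: "\<mu> \<in> ?M" by blast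
    then have z: "z = ereal (c * \<mu>)" by simp
    have "0 < c * \<mu>" using \<mu> assms by simp
    moreover have "\<forall>x. ereal (x \<bullet> (c *\<^sub>R y)) \<le> ereal (c * \<mu>) * g x" using \<mu> iff by blast
    ultimately show "z \<in> ?L" using z by blast
  qed
  then have "polar g (c *\<^sub>R y) = Inf {ereal c * z |z. z \<in> ereal ` ?M}"
    by (simp add: polar_def)
  also have "\<dots> = ereal c * Inf {z. z \<in> ereal ` ?M}"
    by (rule ereal_Inf_cmult[OF assms])
  also have "{z. z \<in> ereal ` ?M} = {ereal \<mu> |\<mu>. 0 < \<mu> \<and> (\<forall>x. ereal (x \<bullet> y) \<le> ereal \<mu> * g x)}"
    by auto
  finally show ?thesis by (simp add: polar_def)
qed

lemma dual_objective_scale: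
  assumes "0 < c" "0 \<le> \<sigma>"
  shows "dual_objective \<rho> b \<sigma> (c *\<^sub>R y) = ereal c * dual_objective \<rho> b \<sigma> y"
proof (cases "polar \<rho> y")
  case (real t)
  then show ?thesis by (simp add: dual_objective_def polar_scale[OF assms(1)] algebra_simps)
next
  case PInf
  \<comment> \<open>For \<open>\<sigma> = 0\<close> the products \<open>0 * \<infinity>\<close>
    vanish on both sides; for \<open>\<sigma> > 0\<close> both sides are
    \<open>-\<infinity>\<close>.\<close>
  then show ?thesis using assms
    by (cases "\<sigma> = 0") (auto simp: dual_objective_def polar_scale[OF assms(1)])
next
  case MInf
  then show ?thesis using polar_nonneg[of \<rho> y] by simp
qed

lemma dual_objective_eq_MInf:
  assumes "0 < \<sigma>" "polar \<rho> y = \<infinity>"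
  shows "dual_objective \<rho> b \<sigma> y = -\<infinity>"
  using assms by (simp add: dual_objective_def)

section \<open>Sets of pairs, rays and product neighbourhoods\<close>

lemma pair_set_eqI:
  "(\<And>y s. (y, s) \<in> S \<longleftrightarrow> Q y s) \<Longrightarrow> S = {(y, s) | y s. Q y s}"
  by auto

lemma pair_set_scaleR_eqI:
  fixes S :: "('b::real_vector \<times> real) set"
  assumes "p \<noteq> 0" and S: "\<And>y t. (p *\<^sub>R y, p * t) \<in> S \<longleftrightarrow> Q y t"
  shows "S = {p *\<^sub>R (y, t) | y t. Q y t}"
proof (intro equalityI subsetI)
  fix z assume "z \<in> S"
  obtain y t where z: "z = (y, t)" by (cases z)
  have "p *\<^sub>R ((1 / p) *\<^sub>R y) = y" "p * (t / p) = t" using \<open>p \<noteq> 0\<close> by simp_all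
  then have "Q ((1 / p) *\<^sub>R y) (t / p)" "z = p *\<^sub>R ((1 / p) *\<^sub>R y, t / p)"
    using S[of "(1 / p) *\<^sub>R y" "t / p"] \<open>z \<in> S\<close> z by simp_all
  then show "z \<in> {p *\<^sub>R (y, t) | y t. Q y t}" by blast
qed (use S in auto)

text \<open>This is where homogeneity pays off: epigraph points of a gauge may be scaled by any
  \<open>t > 0\<close>, so an inequality affine in \<open>t\<close> holds along a whole ray.\<close>

lemma slope_nonpos_if_ray_bounded:
  fixes w z u :: real
  assumes "\<And>t. 0 < t \<Longrightarrow> w + t * z \<le> u"
  shows "z \<le> 0"
proof (rule ccontr)
  assume "\<not> z \<le> 0"
  then have "0 < z" by simp
  define t where "t = (\<bar>u - w\<bar> + 1) / z"
  have "0 < t" using \<open>0 < z\<close> by (simp add: t_def add_nonneg_pos)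
  moreover have "t * z = \<bar>u - w\<bar> + 1" using \<open>0 < z\<close> by (simp add: t_def)
  ultimately show False using assms[of t] by linarith
qed

lemma interior_zero_PairE:
  fixes E :: "('b::euclidean_space \<times> real) set"
  assumes "(0, 0) \<in> interior E"
  obtains e where "0 < e" "\<And>h k. norm h < e \<Longrightarrow> \<bar>k\<bar> < e \<Longrightarrow> (h, k) \<in> E"
proof -
  obtain d where d: "0 < d" "ball (0, 0) d \<subseteq> E"
    using assms by (auto simp: mem_interior)
  have "(h, k) \<in> E" if "norm h < d / 2" "\<bar>k\<bar> < d / 2" for h k
  proof -
    have "dist (0, 0) (h, k) = norm (h, k)" by (simp add: dist_prod_def norm_prod_def)
    also have "\<dots> \<le> norm h + \<bar>k\<bar>" using norm_Pair_le[of h k] by simp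
    also have "\<dots> < d" using that by simp
    finally show ?thesis by (intro subsetD[OF d(2)]) (simp only: mem_ball)
  qed
  then show ?thesis using that[of "d / 2"] d(1) by auto
qed

section \<open>The value function and the interior of its domain\<close>

locale gauge_problem =
  fixes A :: "'a::euclidean_space \<Rightarrow> 'b::euclidean_space"
    and \<kappa> :: "'a \<Rightarrow> ereal" and \<rho> :: "'b \<Rightarrow> ereal"
    and b :: 'b and \<sigma> :: real
  assumes linear_A: "linear A"
    and gauge_\<kappa>: "gauge_fun \<kappa>"
    and gauge_\<rho>: "gauge_fun \<rho>"
begin

abbreviation v :: "'b \<times> real \<Rightarrow> ereal" where
  "v \<equiv> value_fun \<kappa> \<rho> A b \<sigma>"

lemma perturbation_less_iff:
  "perturbation_fun \<kappa> \<rho> A b \<sigma> x h k < \<alpha> \<longleftrightarrow>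
    \<kappa> x < \<alpha> \<and> \<rho> (b + h - A x) \<le> ereal (\<sigma> + k)"
  by (auto simp: perturbation_fun_def delta_def epi_def)

text \<open>Strictness is what matters: an infimum lies below \<alpha> exactly when some member
  does, attained or not.\<close>

lemma value_less_iff:
  "v (h, k) < \<alpha> \<longleftrightarrow> (\<exists>x. \<kappa> x < \<alpha> \<and> \<rho> (b + h - A x) \<le> ereal (\<sigma> + k))"
  by (simp add: value_fun_def INF_less_iff perturbation_less_iff)

lemma dom_iff:
  "(h, k) \<in> effective_dom v \<longleftrightarrow> (\<exists>x. \<kappa> x < \<infinity> \<and> \<rho> (b + h - A x) \<le> ereal (\<sigma> + k))"
  by (simp only: effective_dom_def mem_Collect_eq value_less_iff)

text \<open>Writing \<open>h = A x - u\<close> turns \<open>b - u\<close> into the residual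
  \<open>b + h - A x\<close>. The free level \<open>k\<close> lets the same fact serve the weak and
  the strict sublevel set.\<close>

lemma minkowski_le_iff:
  "h \<in> minkowski_diff (A ` effective_dom \<kappa>) {u. \<rho> (b - u) \<le> ereal (\<sigma> + k)} \<longleftrightarrow>
    (h, k) \<in> effective_dom v"
proof
  assume "(h, k) \<in> effective_dom v"
  then obtain x where x: "\<kappa> x < \<infinity>" "\<rho> (b + h - A x) \<le> ereal (\<sigma> + k)"
    by (auto simp: dom_iff)
  have "b - (A x - h) = b + h - A x" "h = A x - (A x - h)" by (simp_all add: algebra_simps)
  then have "A x - h \<in> {u. \<rho> (b - u) \<le> ereal (\<sigma> + k)}" "A x \<in> A ` effective_dom \<kappa>"
    using x by (simp_all only: effective_dom_def mem_Collect_eq imageI)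
  then show "h \<in> minkowski_diff (A ` effective_dom \<kappa>) {u. \<rho> (b - u) \<le> ereal (\<sigma> + k)}"
    unfolding minkowski_diff_def using \<open>h = A x - (A x - h)\<close> by blast
next
  assume "h \<in> minkowski_diff (A ` effective_dom \<kappa>) {u. \<rho> (b - u) \<le> ereal (\<sigma> + k)}"
  then obtain x u where x: "h = A x - u" "\<kappa> x < \<infinity>" "\<rho> (b - u) \<le> ereal (\<sigma> + k)"
    by (auto simp: minkowski_diff_def effective_dom_def)
  moreover have "b + h - A x = b - u" using x(1) by simp
  ultimately show "(h, k) \<in> effective_dom v" unfolding dom_iff by metis
qed

text \<open>Every point of the strict epigraph has an actual \<open>x\<close> behind it, and such
  witnesses can be averaged by linearity of \<open>A\<close> and convexity of both gauges.\<close>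

lemma strict_epigraph_convex: "convex {(z, \<alpha>). v z < ereal \<alpha>}"
proof (rule convexI)
  fix P Q :: "('b \<times> real) \<times> real" and s t :: real
  assume st: "0 \<le> s" "0 \<le> t" "s + t = 1"
    and PQ: "P \<in> {(z, \<alpha>). v z < ereal \<alpha>}" "Q \<in> {(z, \<alpha>). v z < ereal \<alpha>}"
  obtain h1 k1 \<alpha>1 h2 k2 \<alpha>2 where eq: "P = ((h1, k1), \<alpha>1)" "Q = ((h2, k2), \<alpha>2)"
    by (metis surj_pair)
  with PQ have "v (h1, k1) < ereal \<alpha>1" "v (h2, k2) < ereal \<alpha>2" by auto
  then obtain x1 x2 where x1: "\<kappa> x1 < ereal \<alpha>1" "\<rho> (b + h1 - A x1) \<le> ereal (\<sigma> + k1)"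
    and x2: "\<kappa> x2 < ereal \<alpha>2" "\<rho> (b + h2 - A x2) \<le> ereal (\<sigma> + k2)"
    by (auto simp: value_less_iff)
  obtain a1 a2 where a1: "\<kappa> x1 = ereal a1" "a1 < \<alpha>1" and a2: "\<kappa> x2 = ereal a2" "a2 < \<alpha>2"
    using x1(1) x2(1) gauge_nonneg[OF gauge_\<kappa>, of x1] gauge_nonneg[OF gauge_\<kappa>, of x2]
    by (cases "\<kappa> x1"; cases "\<kappa> x2") auto
  let ?x = "s *\<^sub>R x1 + t *\<^sub>R x2"
  have "\<kappa> ?x \<le> ereal (s * a1 + t * a2)"
    using a1 a2 st by (intro gauge_convex_le[OF gauge_\<kappa>]) auto
  \<comment> \<open>Strict inequality survives averaging because \<open>s + t = 1\<close> keeps one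
    weight positive.\<close>
  also have "s * a1 + t * a2 < s * \<alpha>1 + t * \<alpha>2"
    using convex_bound_lt[of "a1 - \<alpha>1" 0 "a2 - \<alpha>2" s t] a1 a2 st by (simp add: algebra_simps)
  finally have \<kappa>x: "\<kappa> ?x < ereal (s * \<alpha>1 + t * \<alpha>2)" by simp
  have "s *\<^sub>R b + t *\<^sub>R b = b" using st(3) by (metis scaleR_add_left scaleR_one)
  then have "b + (s *\<^sub>R h1 + t *\<^sub>R h2) - A ?x
      = s *\<^sub>R (b + h1 - A x1) + t *\<^sub>R (b + h2 - A x2)"
    by (simp add: linear_add[OF linear_A] linear_scale[OF linear_A] algebra_simps)
  moreover have "\<rho> (s *\<^sub>R (b + h1 - A x1) + t *\<^sub>R (b + h2 - A x2))
      \<le> ereal (s * (\<sigma> + k1) + t * (\<sigma> + k2))"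
    using x1 x2 st by (intro gauge_convex_le[OF gauge_\<rho>]) auto
  moreover have "s * (\<sigma> + k1) + t * (\<sigma> + k2) = \<sigma> + (s * k1 + t * k2)"
    using st(3) by (simp add: algebra_simps flip: distrib_left)
  ultimately have "\<rho> (b + (s *\<^sub>R h1 + t *\<^sub>R h2) - A ?x) \<le> ereal (\<sigma> + (s * k1 + t * k2))" by simp
  with \<kappa>x have "v (s *\<^sub>R h1 + t *\<^sub>R h2, s * k1 + t * k2) < ereal (s * \<alpha>1 + t * \<alpha>2)"
    by (auto simp: value_less_iff)
  then show "s *\<^sub>R P + t *\<^sub>R Q \<in> {(z, \<alpha>). v z < ereal \<alpha>}"
    by (simp add: eq)
qed

lemma dom_convex: "convex (effective_dom v)"
proof -
  have "effective_dom v = fst ` {(z, \<alpha>). v z < ereal \<alpha>}"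
  proof (intro equalityI subsetI)
    fix z assume "z \<in> effective_dom v"
    then obtain \<alpha> where "v z < ereal \<alpha>"
      using less_PInf_Ex_of_nat[of "v z"] by (auto simp: effective_dom_def)
    then show "z \<in> fst ` {(z, \<alpha>). v z < ereal \<alpha>}" by force
  qed (auto simp: effective_dom_def)
  then show ?thesis
    using convex_linear_image[OF linear_fst strict_epigraph_convex] by simp
qed

lemma dom_slice_convex: "convex {h. (h, k) \<in> effective_dom v}"
proof (rule convexI, clarify)
  fix x y and s t :: real
  assume st: "0 \<le> s" "0 \<le> t" "s + t = 1"
    and "(x, k) \<in> effective_dom v" "(y, k) \<in> effective_dom v"
  then have "s *\<^sub>R (x, k) + t *\<^sub>R (y, k) \<in> effective_dom v"
    by (intro convexD[OF dom_convex])
  moreover have "s * k + t * k = k" using st(3) by (metis distrib_right mult_1)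
  ultimately show "(s *\<^sub>R x + t *\<^sub>R y, k) \<in> effective_dom v" by simp
qed

lemma dom_mono: "(h, k) \<in> effective_dom v \<Longrightarrow> k \<le> k' \<Longrightarrow> (h, k') \<in> effective_dom v"
  unfolding dom_iff by (meson add_left_mono ereal_less_eq(3) order_trans)

text \<open>A strict bound by \<open>\<sigma>\<close> is a weak bound by some
  \<open>\<sigma> + k\<close> with \<open>k < 0\<close>; a real \<open>m\<close> between
  \<open>\<rho> (b - u)\<close> and \<open>\<sigma>\<close> supplies
  \<open>k = m - \<sigma>\<close>.\<close>

lemma minkowski_less_iff:
  "h \<in> minkowski_diff (A ` effective_dom \<kappa>) {u. \<rho> (b - u) < ereal \<sigma>} \<longleftrightarrow>
    (\<exists>k<0. (h, k) \<in> effective_dom v)"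
proof
  assume "h \<in> minkowski_diff (A ` effective_dom \<kappa>) {u. \<rho> (b - u) < ereal \<sigma>}"
  then obtain p u where pu: "h = p - u" "p \<in> A ` effective_dom \<kappa>" "\<rho> (b - u) < ereal \<sigma>"
    by (auto simp: minkowski_diff_def)
  obtain m where m: "\<rho> (b - u) < ereal m" "m < \<sigma>"
    using pu(3) ereal_dense2[of "\<rho> (b - u)" "ereal \<sigma>"] by auto
  have "h \<in> minkowski_diff (A ` effective_dom \<kappa>) {u. \<rho> (b - u) \<le> ereal (\<sigma> + (m - \<sigma>))}"
    unfolding minkowski_diff_def using pu m less_imp_le by fastforce
  then show "\<exists>k<0. (h, k) \<in> effective_dom v"
    using m(2) unfolding minkowski_le_iff by (intro exI[of _ "m - \<sigma>"]) simp
next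
  assume "\<exists>k<0. (h, k) \<in> effective_dom v"
  then obtain k where k: "k < 0"
      "h \<in> minkowski_diff (A ` effective_dom \<kappa>) {u. \<rho> (b - u) \<le> ereal (\<sigma> + k)}"
    by (auto simp: minkowski_le_iff)
  moreover have "{u. \<rho> (b - u) \<le> ereal (\<sigma> + k)} \<subseteq> {u. \<rho> (b - u) < ereal \<sigma>}"
    using k(1) by (auto intro: le_less_trans)
  ultimately show "h \<in> minkowski_diff (A ` effective_dom \<kappa>) {u. \<rho> (b - u) < ereal \<sigma>}"
    unfolding minkowski_diff_def by blast
qed

text \<open>Each point on the right brings only a negative level of its own. A common level at the
  vertices of a box spreads to the whole box because slices of the domain are convex and grow with
  \<open>k\<close>.\<close>

lemma interior_dom_iff:
  "(0, 0) \<in> interior (effective_dom v) \<longleftrightarrow>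
    0 \<in> interior (minkowski_diff (A ` effective_dom \<kappa>) {u. \<rho> (b - u) < ereal \<sigma>})"
    (is "_ \<longleftrightarrow> 0 \<in> interior ?S")
proof
  assume "(0, 0) \<in> interior (effective_dom v)"
  then obtain e where e: "0 < e" "\<And>h k. norm h < e \<Longrightarrow> \<bar>k\<bar> < e \<Longrightarrow> (h, k) \<in> effective_dom v"
    by (rule interior_zero_PairE) blast
  have "ball 0 e \<subseteq> ?S"
  proof
    fix h :: 'b assume "h \<in> ball 0 e"
    then have "(h, - (e / 2)) \<in> effective_dom v" using e(1) by (intro e(2)) auto
    then show "h \<in> ?S" using e(1) unfolding minkowski_less_iff by (intro exI[of _ "- (e / 2)"]) simp
  qed
  then show "0 \<in> interior ?S" using e(1) mem_interior by blast
next
  assume "0 \<in> interior ?S"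
  then obtain c d :: 'b where cd: "0 \<in> box c d" "cbox c d \<subseteq> interior ?S"
    using open_contains_cbox open_interior by (metis)
  obtain F where F: "finite F" "cbox c d = convex hull F"
    using closed_interval_as_convex_hull by blast
  \<comment> \<open>Finitely many vertices, so one common level \<open>m < 0\<close> serves the whole box.\<close>
  have "\<forall>h\<in>F. \<exists>k<0. (h, k) \<in> effective_dom v"
    using F(2) hull_subset[of F convex] cd(2) interior_subset[of ?S] minkowski_less_iff by blast
  then obtain k where k: "\<And>h. h \<in> F \<Longrightarrow> k h < 0 \<and> (h, k h) \<in> effective_dom v" by metis
  \<comment> \<open>Inserting -1 keeps the set nonempty, so that \<open>Max\<close> is meaningful,
    and preserves negativity.\<close>
  define m where "m = Max (insert (-1) (k ` F))"
  have "m < 0" using k F(1) by (auto simp: m_def)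
  have "F \<subseteq> {h. (h, m) \<in> effective_dom v}"
  proof
    fix h assume "h \<in> F"
    then have "k h \<le> m" using F(1) by (simp add: m_def)
    then show "h \<in> {h. (h, m) \<in> effective_dom v}" using dom_mono k[OF \<open>h \<in> F\<close>] by blast
  qed
  then have sub: "cbox c d \<subseteq> {h. (h, m) \<in> effective_dom v}"
    unfolding F(2) by (rule hull_minimal) (rule dom_slice_convex)
  \<comment> \<open>Raising the level stays in the domain, and \<open>m < 0\<close> puts the origin
    inside this open product.\<close>
  have "box c d \<times> {m<..} \<subseteq> effective_dom v"
  proof
    fix z assume z: "z \<in> box c d \<times> {m<..}"
    then have "(fst z, m) \<in> effective_dom v" "m \<le> snd z"
      using sub box_subset_cbox[of c d] by auto
    then show "z \<in> effective_dom v" using dom_mono[of "fst z" m "snd z"] by simp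
  qed
  moreover have "open (box c d \<times> {m<..})" by (intro open_Times open_box open_greaterThan)
  moreover have "(0, 0) \<in> box c d \<times> {m<..}" using cd(1) \<open>m < 0\<close> by simp
  ultimately show "(0, 0) \<in> interior (effective_dom v)" by (rule interiorI[rotated 2])
qed

section \<open>Subgradients at the origin\<close>

lemma subdifferential_nonempty:
  assumes int: "(0, 0) \<in> interior (effective_dom v)" and p: "v (0, 0) = ereal p"
  shows "subdifferential v (0, 0) \<noteq> {}"
proof -
  let ?C = "{(z, \<alpha>). v z < ereal \<alpha>}"
  have "((0, 0), p + 1) \<in> ?C" "((0, 0), p) \<notin> ?C" using p by auto
  then obtain a c where "a \<noteq> 0" and a: "a \<bullet> ((0, 0), p) \<le> c" "\<And>z. z \<in> ?C \<Longrightarrow> c \<le> a \<bullet> z"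
    using separating_hyperplane_sets[OF convex_singleton strict_epigraph_convex, of "((0, 0), p)"]
    by fastforce
  obtain w \<beta> where w: "a = (w, \<beta>)" by (cases a)
  have ineq: "\<beta> * p \<le> w \<bullet> z + \<beta> * \<alpha>" if "v z < ereal \<alpha>" for z \<alpha>
  proof -
    have "a \<bullet> ((0, 0), p) \<le> a \<bullet> (z, \<alpha>)" using a(1) a(2)[of "(z, \<alpha>)"] that by simp
    moreover have "w \<bullet> (0, 0) = 0" using inner_zero_right[of w] by (simp only: zero_prod_def)
    ultimately show ?thesis by (simp add: w)
  qed
  \<comment> \<open>The point at height \<open>p + 1\<close> above the origin fixes the sign of the
    vertical coefficient.\<close>
  have "0 \<le> \<beta>" using ineq[of "(0, 0)" "p + 1"] p inner_zero_right[of w]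
    by (simp add: zero_prod_def algebra_simps)
  \<comment> \<open>A vertical hyperplane would confine the domain to the half-space
    \<open>0 \<le> w \<bullet> z\<close>, but a short step against \<open>w\<close> from the
    interior point 0 leaves that half-space within the domain.\<close>
  have "\<beta> \<noteq> 0"
  proof
    assume "\<beta> = 0"
    then have "w \<noteq> 0" using \<open>a \<noteq> 0\<close> w by (simp add: zero_prod_def)
    obtain d where d: "0 < d" "ball (0, 0) d \<subseteq> effective_dom v"
      using int by (auto simp: mem_interior)
    define z where "z = - ((d / (2 * norm w)) *\<^sub>R w)"
    have "norm z = d / 2" using d(1) \<open>w \<noteq> 0\<close> by (simp add: z_def)
    then have "z \<in> effective_dom v" using d by (intro subsetD[OF d(2)]) (simp flip: zero_prod_def)
    then obtain \<alpha> where "v z < ereal \<alpha>"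
      using less_PInf_Ex_of_nat[of "v z"] by (auto simp: effective_dom_def)
    then have "0 \<le> w \<bullet> z" using ineq \<open>\<beta> = 0\<close> by fastforce
    moreover have "0 < d / (2 * norm w) * (w \<bullet> w)" using d(1) \<open>w \<noteq> 0\<close> by simp
    ultimately show False by (simp add: z_def)
  qed
  then have "0 < \<beta>" using \<open>0 \<le> \<beta>\<close> by simp
  \<comment> \<open>The slope of the separating hyperplane, now that it is the graph of an affine
    function.\<close>
  let ?s = "(- 1 / \<beta>) *\<^sub>R w"
  have "ereal p + ereal (?s \<bullet> z) \<le> v z" for z
  proof (rule ereal_le_real)
    fix \<alpha> assume "v z \<le> ereal \<alpha>"
    \<comment> \<open>The separation inequality is known only on the strict epigraph, hence
      \<open>\<alpha>' > \<alpha>\<close> and a limit.\<close>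
    have "p + ?s \<bullet> z \<le> \<alpha>'" if "\<alpha> < \<alpha>'" for \<alpha>'
    proof -
      have "v z < ereal \<alpha>'" using \<open>v z \<le> ereal \<alpha>\<close> that by (simp add: le_less_trans)
      from ineq[OF this] show ?thesis using \<open>0 < \<beta>\<close> by (simp add: field_simps)
    qed
    then have "p + ?s \<bullet> z \<le> \<alpha>" by (rule dense_ge)
    then show "ereal p + ereal (?s \<bullet> z) \<le> ereal \<alpha>" by simp
  qed
  moreover have "z - (0, 0) = z" for z :: "'b \<times> real" by (simp add: prod_eq_iff)
  ultimately have "?s \<in> subdifferential v (0, 0)"
    unfolding subdifferential_def p by simp
  then show ?thesis by blast
qed

lemma subgradient_iff:
  assumes p: "v (0, 0) = ereal p"
  shows "(y, s) \<in> subdifferential v (0, 0) \<longleftrightarrow>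
    p \<le> b \<bullet> y + \<sigma> * s \<and> polar \<kappa> (adjoint A y) \<le> 1 \<and> s \<le> 0 \<and> polar \<rho> y \<le> ereal (- s)"
    (is "?L \<longleftrightarrow> ?R")
proof
  assume ?L
  \<comment> \<open>Substituting \<open>h = r - b + A x\<close> and
    \<open>k = \<mu> - \<sigma>\<close> makes \<open>x\<close> and the epigraph point
    \<open>(r, \<mu>)\<close> independent variables.\<close>
  have ineq: "p + y \<bullet> (r - b + A x) + s * (\<mu> - \<sigma>) \<le> \<alpha>"
    if x: "\<kappa> x \<le> ereal \<alpha>" and r: "\<rho> r \<le> ereal \<mu>" for x r \<alpha> \<mu>
  proof -
    have "v (r - b + A x, \<mu> - \<sigma>) < ereal \<alpha>'" if "\<alpha> < \<alpha>'" for \<alpha>'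
      using x r that by (auto simp: value_less_iff intro!: exI[of _ x] le_less_trans[OF x])
    moreover have "ereal p + ereal ((y, s) \<bullet> (r - b + A x, \<mu> - \<sigma>)) \<le> v (r - b + A x, \<mu> - \<sigma>)"
      using \<open>?L\<close> p by (auto simp: subdifferential_def)
    ultimately have "ereal p + ereal ((y, s) \<bullet> (r - b + A x, \<mu> - \<sigma>)) < ereal \<alpha>'"
        if "\<alpha> < \<alpha>'" for \<alpha>'
      using that le_less_trans by blast
    then have "p + (y, s) \<bullet> (r - b + A x, \<mu> - \<sigma>) < \<alpha>'" if "\<alpha> < \<alpha>'" for \<alpha>'
      using that by (simp only: plus_ereal.simps less_ereal.simps)
    then have "p + (y, s) \<bullet> (r - b + A x, \<mu> - \<sigma>) \<le> \<alpha>" by (rule dense_ge[OF less_imp_le])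
    then show ?thesis by (simp add: algebra_simps)
  qed
  have zero: "\<kappa> 0 \<le> ereal 0" "\<rho> 0 \<le> ereal 0"
    using gauge_zero[OF gauge_\<kappa>] gauge_zero[OF gauge_\<rho>] by auto
  have A0: "A 0 = 0" by (rule linear_0[OF linear_A])
  \<comment> \<open>With \<open>(r, \<mu>) = (0, 0)\<close> only \<open>x\<close> remains; scaling
    it along its ray shows that the linear part cannot be positive.\<close>
  have \<kappa>_dual: "x \<bullet> adjoint A y \<le> 1 * \<alpha>" if x: "\<kappa> x \<le> ereal \<alpha>" for x \<alpha>
  proof -
    have "x \<bullet> adjoint A y - \<alpha> \<le> 0"
    proof (rule slope_nonpos_if_ray_bounded)
      fix t :: real assume "0 < t"
      have "y \<bullet> A x = x \<bullet> adjoint A y"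
        by (simp add: adjoint_works[OF linear_A] inner_commute)
      then show "p - y \<bullet> b - s * \<sigma> + t * (x \<bullet> adjoint A y - \<alpha>) \<le> 0"
        using ineq[OF gauge_scale_le[OF gauge_\<kappa> \<open>0 < t\<close> x] zero(2)]
        by (simp add: linear_scale[OF linear_A] inner_add_right inner_diff_right algebra_simps)
    qed
    then show ?thesis by simp
  qed
  have \<rho>_dual: "r \<bullet> y + s * \<mu> \<le> 0" if r: "\<rho> r \<le> ereal \<mu>" for r \<mu>
  proof (rule slope_nonpos_if_ray_bounded)
    fix t :: real assume "0 < t"
    then show "p - y \<bullet> b - s * \<sigma> + t * (r \<bullet> y + s * \<mu>) \<le> 0"
      using ineq[OF zero(1) gauge_scale_le[OF gauge_\<rho> \<open>0 < t\<close> r]]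
      by (simp add: A0 inner_diff_right inner_commute algebra_simps)
  qed
  \<comment> \<open>The vertical direction \<open>(0, 1)\<close> lies in the epigraph of
    \<open>\<rho>\<close>.\<close>
  have "s \<le> 0" using \<rho>_dual[of 0 1] gauge_zero[OF gauge_\<rho>] by simp
  moreover have "polar \<kappa> (adjoint A y) \<le> ereal 1"
    using \<kappa>_dual by (subst polar_le_iff) (auto simp: gauge_nonneg[OF gauge_\<kappa>])
  moreover have "polar \<rho> y \<le> ereal (- s)"
  proof (subst polar_le_iff)
    show "\<forall>r \<mu>. \<rho> r \<le> ereal \<mu> \<longrightarrow> r \<bullet> y \<le> - s * \<mu>"
    proof (intro allI impI)
      fix r \<mu> assume "\<rho> r \<le> ereal \<mu>"
      from \<rho>_dual[OF this] show "r \<bullet> y \<le> - s * \<mu>" by simp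
    qed
  qed (use gauge_nonneg[OF gauge_\<rho>] \<open>s \<le> 0\<close> in auto)
  \<comment> \<open>Both gauges are tested at 0, that is, at \<open>h = - b\<close> and
    \<open>k = - \<sigma>\<close>.\<close>
  moreover have "p \<le> b \<bullet> y + \<sigma> * s"
    using ineq[OF zero] by (simp add: A0 inner_commute algebra_simps)
  ultimately show ?R by (simp add: one_ereal_def)
next
  assume R: ?R
  then have \<kappa>_dual: "x \<bullet> adjoint A y \<le> \<alpha>" if "\<kappa> x \<le> ereal \<alpha>" for x \<alpha>
    using that polar_le_iff[of \<kappa> 1 "adjoint A y", OF gauge_nonneg[OF gauge_\<kappa>]]
    by (simp add: one_ereal_def)
  from R have \<rho>_dual: "r \<bullet> y \<le> - s * \<mu>" if "\<rho> r \<le> ereal \<mu>" for r \<mu>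
    using that polar_le_iff[of \<rho> "- s" y, OF gauge_nonneg[OF gauge_\<rho>]] by simp
  have ineq: "ereal p + ereal ((y, s) \<bullet> (h, k)) \<le> v (h, k)" for h k
  proof (rule ccontr)
    assume "\<not> ?thesis"
    then obtain x where x: "\<kappa> x < ereal (p + (y, s) \<bullet> (h, k))"
        "\<rho> (b + h - A x) \<le> ereal (\<sigma> + k)"
      by (auto simp: not_le value_less_iff)
    obtain \<alpha> where \<alpha>: "\<kappa> x = ereal \<alpha>" "\<alpha> < p + (y, s) \<bullet> (h, k)"
      using x(1) gauge_nonneg[OF gauge_\<kappa>, of x] by (cases "\<kappa> x") auto
    \<comment> \<open>The pairing of \<open>b + h\<close> with \<open>y\<close> splits into
      \<open>A x\<close> and the residual, each controlled by one polar inequality.\<close>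
    have "A x \<bullet> y \<le> \<alpha>" using \<kappa>_dual[of x \<alpha>] \<alpha>(1) by (simp add: adjoint_works[OF linear_A])
    moreover have "b \<bullet> y + h \<bullet> y - A x \<bullet> y \<le> - s * (\<sigma> + k)"
      using \<rho>_dual[OF x(2)] by (simp add: inner_add_left inner_diff_left)
    ultimately show False
      using \<alpha>(2) R by (simp add: algebra_simps inner_commute)
  qed
  have "ereal p + ereal ((y, s) \<bullet> z) \<le> v z" for z by (cases z) (simp only: ineq)
  moreover have "z - (0, 0) = z" for z :: "'b \<times> real" by (simp add: prod_eq_iff)
  ultimately show ?L unfolding subdifferential_def p by (simp del: split_paired_All)
qed

section \<open>Weak duality and the first dual problem\<close>

lemma weak_duality:
  assumes p: "v (0, 0) = ereal p" and "0 < \<sigma>" "0 \<le> a" "polar \<kappa> (adjoint A y) \<le> ereal a"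
  shows "dual_objective \<rho> b \<sigma> y \<le> ereal (a * p)"
proof (cases "polar \<rho> y")
  case (real t)
  then have "0 \<le> t" using polar_nonneg[of \<rho> y] by simp
  \<comment> \<open>For feasible \<open>x\<close>, \<open>b \<bullet> y\<close> is the sum of
    \<open>x \<bullet> adjoint A y\<close> and \<open>(b - A x) \<bullet> y\<close>, and the two
    polars bound these terms. The factor \<open>a\<close> will be 1 in the first dual problem and
    the value of the polar in the second.\<close>
  have bound: "b \<bullet> y - \<sigma> * t \<le> a * \<alpha>" if "p < \<alpha>" for \<alpha>
  proof -
    have "v (0, 0) < ereal \<alpha>" using p that by simp
    then obtain x where x: "\<kappa> x < ereal \<alpha>" "\<rho> (b - A x) \<le> ereal \<sigma>"
      by (auto simp: value_less_iff)
    have "x \<bullet> adjoint A y \<le> a * \<alpha>"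
      using polar_le_iff[of \<kappa> a "adjoint A y"] gauge_nonneg[OF gauge_\<kappa>] assms x(1) by auto
    moreover have "(b - A x) \<bullet> y \<le> t * \<sigma>"
      using polar_le_iff[of \<rho> t y] gauge_nonneg[OF gauge_\<rho>] \<open>0 \<le> t\<close> real x(2) by auto
    ultimately show ?thesis
      by (simp add: adjoint_works[OF linear_A] inner_diff_left algebra_simps)
  qed
  have "b \<bullet> y - \<sigma> * t \<le> a * p"
  proof (cases "a = 0")
    case True
    then show ?thesis using bound[of "p + 1"] by simp
  next
    case False
    then have "0 < a" using \<open>0 \<le> a\<close> by simp
    have "(b \<bullet> y - \<sigma> * t) / a \<le> p"
      by (rule dense_ge) (use bound \<open>0 < a\<close> in \<open>simp add: field_simps\<close>)
    then show ?thesis using \<open>0 < a\<close> by (simp add: field_simps)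
  qed
  then show ?thesis using real by (simp add: dual_objective_def)
next
  case PInf
  then show ?thesis using dual_objective_eq_MInf[OF \<open>0 < \<sigma>\<close> PInf] by simp
next
  case MInf
  then show ?thesis using polar_nonneg[of \<rho> y] by simp
qed

text \<open>With \<open>t = polar \<rho> y\<close>, weak duality closes the chain \<open>p \<le> b
  \<bullet> y + \<sigma> * s \<le> b \<bullet> y - \<sigma> * t \<le> p\<close>, and
  \<open>\<sigma> > 0\<close> forces \<open>s = - t\<close>. The equation in \<open>ereal\<close>
  also records that the polar is finite.\<close>

lemma subgradient_iff_dual_optimal:
  assumes p: "v (0, 0) = ereal p" and "0 < \<sigma>"
  shows "(y, s) \<in> subdifferential v (0, 0) \<longleftrightarrow> ereal s = - polar \<rho> y \<and>
    polar \<kappa> (adjoint A y) \<le> 1 \<and> dual_objective \<rho> b \<sigma> y = ereal p"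
proof (cases "polar \<rho> y")
  case (real t)
  then have "0 \<le> t" using polar_nonneg[of \<rho> y] by simp
  have weak: "b \<bullet> y - \<sigma> * t \<le> p" if "polar \<kappa> (adjoint A y) \<le> 1"
    using weak_duality[OF p \<open>0 < \<sigma>\<close> zero_le_one, of y] that real
    by (simp add: dual_objective_def one_ereal_def)
  have obj: "dual_objective \<rho> b \<sigma> y = ereal p \<longleftrightarrow> b \<bullet> y - \<sigma> * t = p"
    using real by (simp add: dual_objective_def)
  have sub: "(y, s) \<in> subdifferential v (0, 0) \<longleftrightarrow>
      p \<le> b \<bullet> y + \<sigma> * s \<and> polar \<kappa> (adjoint A y) \<le> 1 \<and> s \<le> 0 \<and> t \<le> - s"
    unfolding subgradient_iff[OF p] real by simp
  have s_eq: "s = - t" if "polar \<kappa> (adjoint A y) \<le> 1" "p \<le> b \<bullet> y + \<sigma> * s" "t \<le> - s"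
  proof -
    have "\<sigma> * (- s) \<le> \<sigma> * t" using weak[OF that(1)] that(2) by simp
    then have "- s \<le> t" using \<open>0 < \<sigma>\<close> by (simp only: mult_le_cancel_left_pos)
    then show ?thesis using that(3) by simp
  qed
  show ?thesis
  proof
    assume "(y, s) \<in> subdifferential v (0, 0)"
    then have R: "p \<le> b \<bullet> y + \<sigma> * s" "polar \<kappa> (adjoint A y) \<le> 1" "t \<le> - s"
      unfolding sub by auto
    have s: "s = - t" by (rule s_eq[OF R(2,1,3)])
    have "b \<bullet> y - \<sigma> * t = p" using R(1) weak[OF R(2)] by (simp add: s)
    then show "ereal s = - polar \<rho> y \<and> polar \<kappa> (adjoint A y) \<le> 1 \<and>
        dual_objective \<rho> b \<sigma> y = ereal p"
      using R(2) real s obj by simp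
  next
    assume "ereal s = - polar \<rho> y \<and> polar \<kappa> (adjoint A y) \<le> 1 \<and>
        dual_objective \<rho> b \<sigma> y = ereal p"
    then have "s = - t" "polar \<kappa> (adjoint A y) \<le> 1" "b \<bullet> y - \<sigma> * t = p"
      using real obj by simp_all
    then show "(y, s) \<in> subdifferential v (0, 0)" unfolding sub using \<open>0 \<le> t\<close> by simp
  qed
next
  case PInf
  then show ?thesis by (simp add: subgradient_iff[OF p])
next
  case MInf
  then show ?thesis using polar_nonneg[of \<rho> y] by simp
qed

text \<open>Strong duality with attainment: the first component of any subgradient is a dual
  solution.\<close>

lemma dual_attained:
  assumes int: "(0, 0) \<in> interior (effective_dom v)" and p: "v (0, 0) = ereal p" and "0 < \<sigma>"
  obtains y where "polar \<kappa> (adjoint A y) \<le> 1" "dual_objective \<rho> b \<sigma> y = ereal p"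
proof -
  obtain y s where "(y, s) \<in> subdifferential v (0, 0)"
    using subdifferential_nonempty[OF int p] by (metis ex_in_conv surj_pair)
  then show thesis
    unfolding subgradient_iff_dual_optimal[OF p \<open>0 < \<sigma>\<close>] by (elim conjE) (rule that)
qed


text \<open>Because some \<open>y0\<close> reaches the weak-duality bound \<open>p\<close>, being a
  maximizer means exactly reaching \<open>p\<close>.\<close>

lemma subdifferential_eq_arg_max:
  assumes int: "(0, 0) \<in> interior (effective_dom v)" and p: "v (0, 0) = ereal p" and "0 < \<sigma>"
  shows "subdifferential v (0, 0) = {(y, s) | y s. ereal s = - polar \<rho> y \<and>
    is_arg_max (dual_objective \<rho> b \<sigma>) (\<lambda>y. polar \<kappa> (adjoint A y) \<le> 1) y}"
proof -
  obtain y0 where y0: "polar \<kappa> (adjoint A y0) \<le> 1" "dual_objective \<rho> b \<sigma> y0 = ereal p"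
    by (rule dual_attained[OF int p \<open>0 < \<sigma>\<close>])
  have weak: "dual_objective \<rho> b \<sigma> y \<le> ereal p" if "polar \<kappa> (adjoint A y) \<le> 1" for y
    using weak_duality[OF p \<open>0 < \<sigma>\<close> zero_le_one, of y] that by (simp add: one_ereal_def)
  have "is_arg_max (dual_objective \<rho> b \<sigma>) (\<lambda>y. polar \<kappa> (adjoint A y) \<le> 1) y \<longleftrightarrow>
      polar \<kappa> (adjoint A y) \<le> 1 \<and> dual_objective \<rho> b \<sigma> y = ereal p" for y
  proof
    assume "is_arg_max (dual_objective \<rho> b \<sigma>) (\<lambda>y. polar \<kappa> (adjoint A y) \<le> 1) y"
    then have y: "polar \<kappa> (adjoint A y) \<le> 1" "dual_objective \<rho> b \<sigma> y0 \<le> dual_objective \<rho> b \<sigma> y"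
      using y0(1) unfolding is_arg_max_linorder by blast+
    then show "polar \<kappa> (adjoint A y) \<le> 1 \<and> dual_objective \<rho> b \<sigma> y = ereal p"
      using order_antisym[OF weak[OF y(1)]] y0(2) by simp
  next
    assume "polar \<kappa> (adjoint A y) \<le> 1 \<and> dual_objective \<rho> b \<sigma> y = ereal p"
    then show "is_arg_max (dual_objective \<rho> b \<sigma>) (\<lambda>y. polar \<kappa> (adjoint A y) \<le> 1) y"
      using weak unfolding is_arg_max_linorder by simp
  qed
  then show ?thesis
    by (intro pair_set_eqI) (simp only: subgradient_iff_dual_optimal[OF p \<open>0 < \<sigma>\<close>])
qed

section \<open>Rescaling to the second dual problem\<close>

lemma polar_adjoint_scale:
  assumes "0 < c"
  shows "polar \<kappa> (adjoint A (c *\<^sub>R y)) = ereal c * polar \<kappa> (adjoint A y)"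
  by (simp only: linear_scale[OF adjoint_linear[OF linear_A]] polar_scale[OF assms])

lemma polar_adjoint_scale_le_1:
  assumes "0 < c"
  shows "polar \<kappa> (adjoint A (c *\<^sub>R y)) \<le> 1 \<longleftrightarrow> polar \<kappa> (adjoint A y) \<le> ereal (1 / c)"
proof (cases "polar \<kappa> (adjoint A y)")
  case (real a)
  have "c * a \<le> 1 \<longleftrightarrow> a \<le> 1 / c" using assms by (simp add: pos_le_divide_eq mult.commute)
  then show ?thesis unfolding polar_adjoint_scale[OF assms] real by (simp add: one_ereal_def)
next
  case PInf
  then show ?thesis unfolding polar_adjoint_scale[OF assms] using assms by simp
next
  case MInf
  then show ?thesis using polar_nonneg[of \<kappa> "adjoint A y"] by simp
qed

text \<open>The minimal value is \<open>1 / p\<close>: weak duality with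
  \<open>a = polar \<kappa> (adjoint A z)\<close> gives \<open>1 \<le> a * p\<close> for feasible
  \<open>z\<close>, and dividing a maximizer \<open>y0\<close> of the first problem by
  \<open>p\<close> attains it.\<close>

lemma arg_min_iff_dual_optimal:
  assumes int: "(0, 0) \<in> interior (effective_dom v)" and p: "v (0, 0) = ereal p"
    and "0 < \<sigma>" "0 < p"
  shows "is_arg_min (\<lambda>y. polar \<kappa> (adjoint A y)) (\<lambda>y. dual_objective \<rho> b \<sigma> y \<ge> 1) y \<longleftrightarrow>
    polar \<kappa> (adjoint A (p *\<^sub>R y)) \<le> 1 \<and> dual_objective \<rho> b \<sigma> (p *\<^sub>R y) = ereal p"
proof -
  have obj: "dual_objective \<rho> b \<sigma> (p *\<^sub>R y) = ereal p * dual_objective \<rho> b \<sigma> y" for y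
    using dual_objective_scale[of p \<sigma>] \<open>0 < \<sigma>\<close> \<open>0 < p\<close> by simp
  have obj_iff: "dual_objective \<rho> b \<sigma> y \<ge> 1 \<longleftrightarrow> dual_objective \<rho> b \<sigma> (p *\<^sub>R y) \<ge> ereal p" for y
    unfolding obj using \<open>0 < p\<close>
    by (cases "dual_objective \<rho> b \<sigma> y") (simp_all add: one_ereal_def)
  have weak: "dual_objective \<rho> b \<sigma> y \<le> ereal p" if "polar \<kappa> (adjoint A y) \<le> 1" for y
    using weak_duality[OF p \<open>0 < \<sigma>\<close> zero_le_one, of y] that by (simp add: one_ereal_def)
  obtain y0 where y0: "polar \<kappa> (adjoint A y0) \<le> 1" "dual_objective \<rho> b \<sigma> y0 = ereal p"
    by (rule dual_attained[OF int p \<open>0 < \<sigma>\<close>])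
  define y1 where "y1 = (1 / p) *\<^sub>R y0"
  have py1: "p *\<^sub>R y1 = y0" using \<open>0 < p\<close> by (simp add: y1_def)
  have y1: "dual_objective \<rho> b \<sigma> y1 \<ge> 1" "polar \<kappa> (adjoint A y1) \<le> ereal (1 / p)"
    unfolding obj_iff polar_adjoint_scale_le_1[OF \<open>0 < p\<close>, symmetric] py1 using y0 by simp_all
  have lower: "ereal (1 / p) \<le> polar \<kappa> (adjoint A z)" if z: "dual_objective \<rho> b \<sigma> z \<ge> 1" for z
  proof (cases "polar \<kappa> (adjoint A z)")
    case (real a)
    then have "0 \<le> a" using polar_nonneg[of \<kappa> "adjoint A z"] by simp
    have "dual_objective \<rho> b \<sigma> z \<le> ereal (a * p)"
      using weak_duality[OF p \<open>0 < \<sigma>\<close> \<open>0 \<le> a\<close>, of z] real by simp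
    from order_trans[OF z this] have "1 \<le> a * p" by (simp add: one_ereal_def)
    then show ?thesis using real \<open>0 < p\<close> by (simp add: pos_divide_le_eq)
  qed (use polar_nonneg[of \<kappa> "adjoint A z"] in auto)
  have "is_arg_min (\<lambda>y. polar \<kappa> (adjoint A y)) (\<lambda>y. dual_objective \<rho> b \<sigma> y \<ge> 1) y \<longleftrightarrow>
      dual_objective \<rho> b \<sigma> y \<ge> 1 \<and> polar \<kappa> (adjoint A y) \<le> ereal (1 / p)"
    unfolding is_arg_min_linorder using y1 lower by (blast intro: order_trans)
  \<comment> \<open>After scaling, the constraint reads \<open>\<ge> p\<close> while weak duality
    gives \<open>\<le> p\<close>, hence equality.\<close>
  also have "\<dots> \<longleftrightarrow> polar \<kappa> (adjoint A (p *\<^sub>R y)) \<le> 1 \<and> dual_objective \<rho> b \<sigma> (p *\<^sub>R y) = ereal p"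
    unfolding obj_iff polar_adjoint_scale_le_1[OF \<open>0 < p\<close>, symmetric]
    using weak by (metis order_antisym order_refl)
  finally show ?thesis .
qed

lemma subdifferential_eq_arg_min:
  assumes int: "(0, 0) \<in> interior (effective_dom v)" and p: "v (0, 0) = ereal p"
    and "0 < \<sigma>" "0 < p"
  shows "subdifferential v (0, 0) = {p *\<^sub>R (y, t) | y t. ereal t = - polar \<rho> y \<and>
    is_arg_min (\<lambda>y. polar \<kappa> (adjoint A y)) (\<lambda>y. dual_objective \<rho> b \<sigma> y \<ge> 1) y}"
proof -
  \<comment> \<open>The second component has to scale along with the first; positive homogeneity of
    the polar ensures this.\<close>
  have polar_iff: "ereal t = - polar \<rho> y \<longleftrightarrow> ereal (p * t) = - polar \<rho> (p *\<^sub>R y)" for y t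
  proof (cases "polar \<rho> y")
    case (real r)
    have "p * t = - (p * r) \<longleftrightarrow> t = - r"
      using \<open>0 < p\<close> mult_cancel_left[of p t "- r"] by simp
    then show ?thesis unfolding polar_scale[OF \<open>0 < p\<close>] real by simp
  next
    case PInf
    then show ?thesis unfolding polar_scale[OF \<open>0 < p\<close>] using \<open>0 < p\<close> by simp
  next
    case MInf
    then show ?thesis using polar_nonneg[of \<rho> y] by simp
  qed
  have iff: "(p *\<^sub>R y, p * t) \<in> subdifferential v (0, 0) \<longleftrightarrow> ereal t = - polar \<rho> y \<and>
      is_arg_min (\<lambda>y. polar \<kappa> (adjoint A y)) (\<lambda>y. dual_objective \<rho> b \<sigma> y \<ge> 1) y" for y t
    unfolding subgradient_iff_dual_optimal[OF p \<open>0 < \<sigma>\<close>] polar_iff[of t y]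
      arg_min_iff_dual_optimal[OF int p \<open>0 < \<sigma>\<close> \<open>0 < p\<close>] by (rule refl)
  show ?thesis
    by (rule pair_set_scaleR_eqI[OF less_imp_neq[OF \<open>0 < p\<close>, symmetric] iff])
qed

text \<open>The perturbation \<open>h = 0\<close>, \<open>k = - (e / 2)\<close> stays in the domain,
  so \<open>\<sigma> - e / 2\<close> bounds a gauge value from above and is nonnegative.\<close>

lemma interior_dom_imp_\<sigma>_pos:
  assumes "(0, 0) \<in> interior (effective_dom v)"
  shows "0 < \<sigma>"
proof -
  obtain e where e: "0 < e" "\<And>h k. norm h < e \<Longrightarrow> \<bar>k\<bar> < e \<Longrightarrow> (h, k) \<in> effective_dom v"
    using assms by (rule interior_zero_PairE) blast
  have "(0, - (e / 2)) \<in> effective_dom v" using e(1) by (intro e(2)) auto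
  then have "0 \<le> \<sigma> + - (e / 2)"
    using gauge_bound_nonneg[OF gauge_\<rho>] by (auto simp only: dom_iff)
  then show ?thesis using e(1) by simp
qed

end

theorem proposition6p1:
  fixes A :: "'a::euclidean_space \<Rightarrow> 'b::euclidean_space"
    and \<kappa> :: "'a \<Rightarrow> ereal" and \<rho> :: "'b \<Rightarrow> ereal"
    and b :: 'b and \<sigma> :: real
  assumes "linear A"
    and "gauge_fun \<kappa>"
    and "closed_gauge \<rho>"
    and "0 \<le> \<sigma>"
    and "\<sigma> = 0 \<Longrightarrow> \<rho> -` {0} = {0}"
  shows
    "(effective_dom (\<lambda>x. perturbation_fun \<kappa> \<rho> A b \<sigma> x 0 0) \<noteq> {} \<longleftrightarrow>
       0 \<in> minkowski_diff (A ` effective_dom \<kappa>) {u. \<rho> (b - u) \<le> ereal \<sigma>}) \<and>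
     ((0, 0) \<in> interior (effective_dom (value_fun \<kappa> \<rho> A b \<sigma>)) \<longleftrightarrow>
       0 \<in> interior (minkowski_diff (A ` effective_dom \<kappa>) {u. \<rho> (b - u) < ereal \<sigma>})) \<and>
     ((0, 0) \<in> interior (effective_dom (value_fun \<kappa> \<rho> A b \<sigma>)) \<and> value_fun \<kappa> \<rho> A b \<sigma> (0, 0) > 0 \<longrightarrow>
       subdifferential (value_fun \<kappa> \<rho> A b \<sigma>) (0, 0) \<noteq> {} \<and>
       subdifferential (value_fun \<kappa> \<rho> A b \<sigma>) (0, 0) =
         {(y, t) | y t. ereal t = - polar \<rho> y \<and>
            is_arg_max (dual_objective \<rho> b \<sigma>) (\<lambda>y. polar \<kappa> (adjoint A y) \<le> 1) y} \<and>
       subdifferential (value_fun \<kappa> \<rho> A b \<sigma>) (0, 0) =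
         {c *\<^sub>R (y, t) | c y t. ereal c = value_fun \<kappa> \<rho> A b \<sigma> (0, 0) \<and> ereal t = - polar \<rho> y \<and>
            is_arg_min (\<lambda>y. polar \<kappa> (adjoint A y)) (\<lambda>y. dual_objective \<rho> b \<sigma> y \<ge> 1) y})"
proof -
  interpret gauge_problem A \<kappa> \<rho> b \<sigma>
    using assms by (intro gauge_problem.intro) (auto simp: closed_gauge_def)
  have dom: "effective_dom (\<lambda>x. perturbation_fun \<kappa> \<rho> A b \<sigma> x 0 0) \<noteq> {} \<longleftrightarrow>
      0 \<in> minkowski_diff (A ` effective_dom \<kappa>) {u. \<rho> (b - u) \<le> ereal \<sigma>}"
  proof -
    have "effective_dom (\<lambda>x. perturbation_fun \<kappa> \<rho> A b \<sigma> x 0 0) \<noteq> {} \<longleftrightarrow>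
        (\<exists>x. perturbation_fun \<kappa> \<rho> A b \<sigma> x 0 0 < \<infinity>)"
      unfolding effective_dom_def by blast
    also have "\<dots> \<longleftrightarrow> (0, 0) \<in> effective_dom v"
      unfolding perturbation_less_iff dom_iff by (rule refl)
    finally show ?thesis using minkowski_le_iff[of 0 0] by simp
  qed
  show ?thesis
  proof (intro conjI impI dom interior_dom_iff; (elim conjE)?)
    assume int: "(0, 0) \<in> interior (effective_dom v)" and pos: "v (0, 0) > 0"
    have "v (0, 0) < \<infinity>" using int interior_subset by (force simp: effective_dom_def)
    then obtain p where p: "v (0, 0) = ereal p" "0 < p"
      using pos by (cases "v (0, 0)") auto
    have \<sigma>: "0 < \<sigma>" by (rule interior_dom_imp_\<sigma>_pos[OF int])
    show "subdifferential v (0, 0) \<noteq> {}" by (rule subdifferential_nonempty[OF int p(1)])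
    show "subdifferential v (0, 0) = {(y, t) | y t. ereal t = - polar \<rho> y \<and>
        is_arg_max (dual_objective \<rho> b \<sigma>) (\<lambda>y. polar \<kappa> (adjoint A y) \<le> 1) y}"
      by (rule subdifferential_eq_arg_max[OF int p(1) \<sigma>])
    show "subdifferential v (0, 0) =
        {c *\<^sub>R (y, t) | c y t. ereal c = v (0, 0) \<and> ereal t = - polar \<rho> y \<and>
          is_arg_min (\<lambda>y. polar \<kappa> (adjoint A y)) (\<lambda>y. dual_objective \<rho> b \<sigma> y \<ge> 1) y}"
      \<comment> \<open>The bound variable \<open>c\<close> is the real number behind the value of
        \<open>v\<close> at the origin, here \<open>p\<close>.\<close>
      unfolding p(1) using subdifferential_eq_arg_min[OF int p(1) \<sigma> p(2)] by simp
  qed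
qed

end
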